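(* The following properties hold for problem (LB). (i) $(\bar Z,\bar S)$ is a local minimizer of (LB) if and only if it is a local minimizer of $f(Z,S)$ on $\mathcal{B}^Z_{\lambda,\bar Z}\times\underline{\mathcal{B}}^S_{\mathbb{J}_{\bar S}}$, where $\mathcal{B}^Z_{\lambda,\bar Z}:=\{Z\in\mathcal{B}^Z:\mathrm{rank}(Z)\le d,\ \lambda\,\mathrm{rank}(Z)=\lambda\,\mathrm{rank}(\bar Z)\}$. (ii) If $(\bar Z,\bar S)$ is a local minimizer of (LB), then $\mathrm{rank}(\bar Z)\le d$ and there exists $(H_Z,H_S)\in\partial f(\bar Z,\bar S)$ such that $$-H_Z\in N_{\mathcal{B}^Z_{\lambda,\bar Z}}(\bar Z),\qquad -H_S\in N_{\underline{\mathcal{B}}^S_{\mathbb{J}_{\bar S}}}(\bar S).$$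
   Context: Let $m,n,d$ be positive integers, $\lambda,\beta\ge 0$, and let $f:\mathbb{R}^{m\times n}\times\mathbb{R}^{m\times n}\to[0,+\infty)$ be locally Lipschitz continuous. $\|S\|_0$ is the number of nonzero entries of $S$. Let $\mathcal{B}^S:=\{S\in\mathbb{R}^{m\times n}:\kappa^1_{ij}\le S_{ij}\le\kappa^2_{ij}\ \forall i,j\}$ with given $\kappa^1_{ij}\in[-\infty,0]$, $\kappa^2_{ij}\in[0,+\infty]$, and let $\mathcal{B}^Z\subseteq\mathbb{R}^{m\times n}$ be a box (entrywise product of closed, possibly unbounded, intervals). Problem (LB): minimize $F_0(Z,S):=f(Z,S)+2\lambda\,\mathrm{rank}(Z)+\beta\|S\|_0$ over $(Z,S)\in\mathcal{B}^Z\times\mathcal{B}^S$ with $\mathrm{rank}(Z)\le d$. $\mathbb{J}_S:=\{(i,j)\in[m]\times[n]:S_{ij}\neq0\}$ if $\beta>0$, and $\mathbb{J}_S:=[m]\times[n]$ if $\beta=0$. For $\mathbb{J}\subseteq[m]\times[n]$, $\underline{\mathcal{B}}^S_{\mathbb{J}}$ is the set of matrices obtained from elements of $\mathcal{B}^S$ by setting to zero all entries outside $\mathbb{J}$. $\partial$ is the limiting (Mordukhovich) subdifferential and $N_\Omega(\cdot)$ the limiting normal cone, in the sense of Rockafellar–Wets. *)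

theory Defs
  imports "HOL-Analysis.Analysis"
begin

text \<open>The product and vector types carry the Euclidean norm and inner product, so on
  \<open>real^'n^'m\<close> and on pairs of such matrices these are the Frobenius norm and inner product.\<close>

definition locally_lipschitz :: "('a::metric_space \<Rightarrow> 'b::metric_space) \<Rightarrow> bool" where
  "locally_lipschitz f \<longleftrightarrow> (\<forall>x. \<exists>u>0. \<exists>L. L-lipschitz_on (cball x u) f)"

definition local_minimizer_on :: "('a::metric_space \<Rightarrow> real) \<Rightarrow> 'a set \<Rightarrow> 'a \<Rightarrow> bool" where
  "local_minimizer_on f C x \<longleftrightarrow> x \<in> C \<and> (\<exists>e>0. \<forall>y\<in>C. dist y x < e \<longrightarrow> f x \<le> f y)"


text \<open>Rockafellar--Wets variational notions. A regular subgradient satisfies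
  \<open>f y \<ge> f x + v \<bullet> (y - x) + o(norm (y - x))\<close> as \<open>y\<close> tends to \<open>x\<close>, and a regular normal satisfies
  \<open>v \<bullet> (y - x) \<le> o(norm (y - x))\<close> for \<open>y \<in> C\<close>; the limiting objects are obtained by closing up along
  sequences. Functions are finite-valued here. Normal cones are empty at points outside the set.\<close>

definition regular_subdifferential :: "('a::euclidean_space \<Rightarrow> real) \<Rightarrow> 'a \<Rightarrow> 'a set" where
  "regular_subdifferential f x =
     {v. \<forall>e>0. \<forall>\<^sub>F y in at x. f y \<ge> f x + v \<bullet> (y - x) - e * norm (y - x)}"

definition limiting_subdifferential :: "('a::euclidean_space \<Rightarrow> real) \<Rightarrow> 'a \<Rightarrow> 'a set" where
  "limiting_subdifferential f x =
     {v. \<exists>X V. X \<longlonglongrightarrow> x \<and> (\<lambda>k. f (X k)) \<longlonglongrightarrow> f x \<and>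
           (\<forall>k::nat. V k \<in> regular_subdifferential f (X k)) \<and> V \<longlonglongrightarrow> v}"

definition regular_normal_cone :: "'a::euclidean_space set \<Rightarrow> 'a \<Rightarrow> 'a set" where
  "regular_normal_cone C x =
     {v. x \<in> C \<and> (\<forall>e>0. \<forall>\<^sub>F y in at x within C. v \<bullet> (y - x) \<le> e * norm (y - x))}"

definition limiting_normal_cone :: "'a::euclidean_space set \<Rightarrow> 'a \<Rightarrow> 'a set" where
  "limiting_normal_cone C x =
     {v. x \<in> C \<and> (\<exists>X V. X \<longlonglongrightarrow> x \<and> (\<forall>k::nat. X k \<in> C) \<and>
           (\<forall>k. V k \<in> regular_normal_cone C (X k)) \<and> V \<longlonglongrightarrow> v)}"


definition matrix_box :: "(real^'n^'m) set \<Rightarrow> bool" where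
  "matrix_box B \<longleftrightarrow>
     (\<exists>I. (\<forall>i j. closed (I i j) \<and> is_interval (I i j)) \<and> B = {Z. \<forall>i j. Z $ i $ j \<in> I i j})"

definition box_S :: "('m \<Rightarrow> 'n \<Rightarrow> ereal) \<Rightarrow> ('m \<Rightarrow> 'n \<Rightarrow> ereal) \<Rightarrow> (real^'n^'m) set" where
  "box_S \<kappa>1 \<kappa>2 = {S. \<forall>i j. \<kappa>1 i j \<le> ereal (S $ i $ j) \<and> ereal (S $ i $ j) \<le> \<kappa>2 i j}"

definition l0_norm :: "real^'n^'m \<Rightarrow> nat" where
  "l0_norm S = card {(i, j). S $ i $ j \<noteq> 0}"

definition J_set :: "real \<Rightarrow> real^'n^'m \<Rightarrow> ('m \<times> 'n) set" where
  "J_set \<beta> S = (if \<beta> > 0 then {(i, j). S $ i $ j \<noteq> 0} else UNIV)"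

definition restrict_entries :: "('m \<times> 'n) set \<Rightarrow> real^'n^'m \<Rightarrow> real^'n^'m" where
  "restrict_entries J S = (\<chi> i j. if (i, j) \<in> J then S $ i $ j else 0)"

definition box_S_restricted ::
    "('m \<Rightarrow> 'n \<Rightarrow> ereal) \<Rightarrow> ('m \<Rightarrow> 'n \<Rightarrow> ereal) \<Rightarrow> ('m \<times> 'n) set \<Rightarrow> (real^'n^'m) set" where
  "box_S_restricted \<kappa>1 \<kappa>2 J = restrict_entries J ` box_S \<kappa>1 \<kappa>2"

definition box_Z_rank ::
    "(real^'n^'m) set \<Rightarrow> nat \<Rightarrow> real \<Rightarrow> real^'n^'m \<Rightarrow> (real^'n^'m) set" where
  "box_Z_rank BZ d lam Zbar =
     {Z \<in> BZ. rank Z \<le> d \<and> lam * real (rank Z) = lam * real (rank Zbar)}"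

definition LB_objective ::
    "((real^'n^'m) \<times> (real^'n^'m) \<Rightarrow> real) \<Rightarrow> real \<Rightarrow> real \<Rightarrow>
     (real^'n^'m) \<times> (real^'n^'m) \<Rightarrow> real" where
  "LB_objective f lam \<beta> =
     (\<lambda>(Z, S). f (Z, S) + 2 * lam * real (rank Z) + \<beta> * real (l0_norm S))"

definition LB_feasible ::
    "(real^'n^'m) set \<Rightarrow> (real^'n^'m) set \<Rightarrow> nat \<Rightarrow> ((real^'n^'m) \<times> (real^'n^'m)) set" where
  "LB_feasible BZ BS d = {(Z, S). Z \<in> BZ \<and> S \<in> BS \<and> rank Z \<le> d}"

definition LB_local_minimizer ::
    "((real^'n^'m) \<times> (real^'n^'m) \<Rightarrow> real) \<Rightarrow> real \<Rightarrow> real \<Rightarrow> (real^'n^'m) set \<Rightarrow>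
     (real^'n^'m) set \<Rightarrow> nat \<Rightarrow> (real^'n^'m) \<times> (real^'n^'m) \<Rightarrow> bool" where
  "LB_local_minimizer f lam \<beta> BZ BS d =
     local_minimizer_on (LB_objective f lam \<beta>) (LB_feasible BZ BS d)"

end

theory Submission
  imports Defs
begin

text \<open>Rank and \<open>l0_norm\<close> are lower semicontinuous and integer valued, so near a point they either keep their
  value or jump up by at least one, and a jump outweighs the small variation of \<open>f\<close>. This reduces
  (LB) locally to minimizing \<open>f\<close> over a locally closed product set, where first-order optimality in limiting
  form follows by penalization.\<close>

section \<open>Lower semicontinuity of the rank and of the support\<close>

text \<open>Injectivity on the row space of \<open>A\<close> persists under small perturbations of \<open>A\<close>.\<close>

lemma rank_lower_semicontinuous:
  fixes A :: "real^'n^'m"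
  shows "\<exists>e>0. \<forall>B. dist B A \<le> e \<longrightarrow> rank A \<le> rank B"
proof -
  define V where "V = span (rows A)"
  have inj_A: "x = 0" if "x \<in> V" "A *v x = 0" for x
    using that matrix_vector_mul_injective_on_rowspace[of A x 0]
    unfolding V_def by (simp add: span_zero)
  \<comment> \<open>An injective linear map on a closed subspace is bounded below; \<open>c\<close>
    is the modulus that a perturbation must not exhaust.\<close>
  obtain c where c: "c > 0" "\<And>x. x \<in> V \<Longrightarrow> c * norm x \<le> norm (A *v x)"
    using injective_imp_isometric[of V "(*v) A"] inj_A
    unfolding V_def by (auto simp: closed_span matrix_vector_mul_bounded_linear mult.commute)
  \<comment> \<open>\<open>K\<close> converts an entrywise bound into a bound on the operator norm,
    so a distance of at most \<open>c / (2 * K)\<close> gives \<open>onorm\<close> at most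
    \<open>c / 2\<close>.\<close>
  define K where "K = real CARD('m) * real CARD('n)"
  have K: "K > 0" by (simp add: K_def)
  have "rank A \<le> rank B" if B: "dist B A \<le> c / (2 * K)" for B
  proof -
    have "onorm ((*v) (B - A)) \<le> K * (c / (2 * K))"
      unfolding K_def
    proof (rule onorm_le_matrix_component)
      fix i j
      have "\<bar>(B - A) $ i $ j\<bar> \<le> norm (B - A)"
        by (metis Finite_Cartesian_Product.norm_nth_le order_trans real_norm_def)
      then show "\<bar>(B - A) $ i $ j\<bar> \<le> c / (2 * (real CARD('m) * real CARD('n)))"
        using B by (simp add: dist_norm K_def)
    qed
    then have onorm_le: "onorm ((*v) (B - A)) \<le> c / 2" using K by simp
    have inj_B: "x = 0" if x: "x \<in> V" "B *v x = 0" for x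
    proof -
      \<comment> \<open>Since \<open>B *v x = 0\<close>, the vector \<open>A *v x\<close> is, up to
        sign, the image of \<open>x\<close> under the perturbation \<open>B - A\<close>. The latter
        has at most half the size required by \<open>c\<close>, hence \<open>x = 0\<close>.\<close>
      have "c * norm x \<le> norm (A *v x)" using c x by simp
      also have "\<dots> = norm ((B - A) *v x)"
        using x by (simp add: matrix_vector_mult_diff_rdistrib)
      also have "\<dots> \<le> onorm ((*v) (B - A)) * norm x"
        by (rule onorm) (rule matrix_vector_mul_bounded_linear)
      also have "\<dots> \<le> c / 2 * norm x" by (rule mult_right_mono[OF onorm_le]) simp
      finally show "x = 0" using c(1) by simp
    qed
    have inj: "inj_on ((*v) B) V"
    proof (rule inj_onI)
      fix x y assume "x \<in> V" "y \<in> V" "B *v x = B *v y"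
      then have "x - y = 0"
        by (intro inj_B) (auto simp: V_def span_diff matrix_vector_mult_diff_distrib)
      then show "x = y" by simp
    qed
    \<comment> \<open>The row space of \<open>A\<close> has dimension \<open>rank A\<close>, and
      \<open>B\<close> embeds it into its own range.\<close>
    have "rank A = dim V" by (simp add: row_rank_def V_def)
    also have "\<dots> = dim ((*v) B ` V)"
      using inj by (intro dim_image_eq[symmetric]) (auto simp: V_def span_span)
    also have "\<dots> \<le> dim (range ((*v) B))" by (intro dim_subset) auto
    also have "\<dots> = rank B" by (simp add: rank_dim_range)
    finally show ?thesis .
  qed
  moreover have "c / (2 * K) > 0" using c K by simp
  ultimately show ?thesis by blast
qed

lemma closed_rank_le: "closed {A :: real^'n^'m. rank A \<le> r}"
proof -
  have "open {A :: real^'n^'m. r < rank A}"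
    unfolding open_dist
  proof clarify
    fix A :: "real^'n^'m" assume "r < rank A"
    moreover obtain e where "e > 0" "\<And>B. dist B A \<le> e \<Longrightarrow> rank A \<le> rank B"
      using rank_lower_semicontinuous by blast
    ultimately show "\<exists>e>0. \<forall>B. dist B A < e \<longrightarrow> B \<in> {A. r < rank A}"
      by (metis less_imp_le less_le_trans mem_Collect_eq)
  qed
  moreover have "- {A :: real^'n^'m. r < rank A} = {A. rank A \<le> r}" by auto
  ultimately show ?thesis by (metis closed_open double_complement)
qed

lemma support_subset_nearby:
  fixes S :: "real^'n^'m"
  shows "\<exists>e>0. \<forall>T. dist T S < e \<longrightarrow> (\<forall>i j. S $ i $ j \<noteq> 0 \<longrightarrow> T $ i $ j \<noteq> 0)"
proof -
  have "\<forall>\<^sub>F T in nhds S. T $ i $ j \<noteq> 0" if "S $ i $ j \<noteq> 0" for i j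
    using that by (intro tendsto_imp_eventually_ne[of _ "S $ i $ j"] tendsto_vec_nth)
      (auto simp: tendsto_def eventually_nhds)
  then have "\<forall>\<^sub>F T in nhds S. \<forall>i j. S $ i $ j \<noteq> 0 \<longrightarrow> T $ i $ j \<noteq> 0"
    by (intro eventually_all_finite) (auto simp: eventually_mono)
  then show ?thesis by (simp add: eventually_nhds_metric)
qed

section \<open>Normal cones of products\<close>

text \<open>Varying one coordinate with the other frozen stays in the product. Along such a slice
  the inner product and the norm reduce to those of the moving coordinate, so the defining
  inequality passes to each factor.\<close>

lemma regular_normal_cone_Times:
  assumes "v \<in> regular_normal_cone (A \<times> B) p"
  shows "fst v \<in> regular_normal_cone A (fst p)" "snd v \<in> regular_normal_cone B (snd p)"
proof -
  obtain v1 v2 a b where [simp]: "v = (v1, v2)" "p = (a, b)" by fastforce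
  have ab: "a \<in> A" "b \<in> B" using assms by (auto simp: regular_normal_cone_def)
  have *: "\<exists>d>0. \<forall>y\<in>A \<times> B. y \<noteq> p \<and> dist y p < d \<longrightarrow> v \<bullet> (y - p) \<le> e * norm (y - p)" if "e > 0" for e
    using assms that by (auto simp: regular_normal_cone_def eventually_at)
  show "fst v \<in> regular_normal_cone A (fst p)"
    unfolding regular_normal_cone_def eventually_at
  proof (clarsimp simp: ab)
    fix e :: real assume "e > 0"
    from *[OF this] obtain d where d: "d > 0"
      "\<And>y. y \<in> A \<times> B \<Longrightarrow> y \<noteq> p \<Longrightarrow> dist y p < d \<Longrightarrow> v \<bullet> (y - p) \<le> e * norm (y - p)" by blast
    have "v1 \<bullet> (y - a) \<le> e * norm (y - a)" if "y \<in> A" "y \<noteq> a" "dist y a < d" for y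
      using d(2)[of "(y, b)"] that ab by (simp add: dist_Pair_Pair norm_Pair inner_Pair)
    with d(1) show "\<exists>d>0. \<forall>x\<in>A. x \<noteq> a \<and> dist x a < d \<longrightarrow> v1 \<bullet> (x - a) \<le> e * norm (x - a)"
      by blast
  qed
  show "snd v \<in> regular_normal_cone B (snd p)"
    unfolding regular_normal_cone_def eventually_at
  proof (clarsimp simp: ab)
    fix e :: real assume "e > 0"
    from *[OF this] obtain d where d: "d > 0"
      "\<And>y. y \<in> A \<times> B \<Longrightarrow> y \<noteq> p \<Longrightarrow> dist y p < d \<Longrightarrow> v \<bullet> (y - p) \<le> e * norm (y - p)" by blast
    have "v2 \<bullet> (y - b) \<le> e * norm (y - b)" if "y \<in> B" "y \<noteq> b" "dist y b < d" for y
      using d(2)[of "(a, y)"] that ab by (simp add: dist_Pair_Pair norm_Pair inner_Pair)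
    with d(1) show "\<exists>d>0. \<forall>x\<in>B. x \<noteq> b \<and> dist x b < d \<longrightarrow> v2 \<bullet> (x - b) \<le> e * norm (x - b)"
      by blast
  qed
qed

lemma limiting_normal_cone_Times:
  assumes "v \<in> limiting_normal_cone (A \<times> B) p"
  shows "fst v \<in> limiting_normal_cone A (fst p)" "snd v \<in> limiting_normal_cone B (snd p)"
proof -
  obtain X V where p: "p \<in> A \<times> B" and X: "X \<longlonglongrightarrow> p" and XC: "\<And>k::nat. X k \<in> A \<times> B"
    and V: "\<And>k. V k \<in> regular_normal_cone (A \<times> B) (X k)" "V \<longlonglongrightarrow> v"
    using assms unfolding limiting_normal_cone_def by blast
  show "fst v \<in> limiting_normal_cone A (fst p)"
    unfolding limiting_normal_cone_def mem_Collect_eq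
  proof (intro conjI exI allI)
    show "fst p \<in> A" "\<And>k. fst (X k) \<in> A"
      using p XC by (auto simp: mem_Times_iff)
    show "(\<lambda>k. fst (X k)) \<longlonglongrightarrow> fst p" "(\<lambda>k. fst (V k)) \<longlonglongrightarrow> fst v"
      using X V(2) by (auto intro: tendsto_fst)
    show "\<And>k. fst (V k) \<in> regular_normal_cone A (fst (X k))"
      by (rule regular_normal_cone_Times(1)[OF V(1)])
  qed
  show "snd v \<in> limiting_normal_cone B (snd p)"
    unfolding limiting_normal_cone_def mem_Collect_eq
  proof (intro conjI exI allI)
    show "snd p \<in> B" "\<And>k. snd (X k) \<in> B"
      using p XC by (auto simp: mem_Times_iff)
    show "(\<lambda>k. snd (X k)) \<longlonglongrightarrow> snd p" "(\<lambda>k. snd (V k)) \<longlonglongrightarrow> snd v"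
      using X V(2) by (auto intro: tendsto_snd)
    show "\<And>k. snd (V k) \<in> regular_normal_cone B (snd (X k))"
      by (rule regular_normal_cone_Times(2)[OF V(1)])
  qed
qed

section \<open>The limiting Fermat rule\<close>

text \<open>Decoupling by penalization: for \<open>k \<rightarrow> \<infinity>\<close>, minimize
  \<open>f x + k / 2 * (norm (x - y))\<^sup>2 + (norm (x - p))\<^sup>2\<close> over \<open>x\<close> unconstrained near \<open>p\<close> and \<open>y \<in> C\<close> near \<open>p\<close>.
  The quadratic term \<open>(norm (x - p))\<^sup>2\<close> forces the minimizers to converge to \<open>p\<close>, and comparing \<open>(x, y)\<close> with \<open>(y, y)\<close>
  bounds the multipliers \<open>k *\<^sub>R (x - y)\<close>.\<close>

lemma limiting_fermat_rule:
  fixes f :: "'a::euclidean_space \<Rightarrow> real"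
  assumes e: "e > 0" and lip: "L-lipschitz_on (cball p e) f"
    and closed: "closed (C \<inter> cball p e)" and p: "p \<in> C"
    and min: "\<And>y. y \<in> C \<inter> cball p e \<Longrightarrow> f p \<le> f y"
  shows "\<exists>v \<in> limiting_subdifferential f p. - v \<in> limiting_normal_cone C p"
proof -
  define D where "D = C \<inter> cball p e"
  define P where "P = (\<lambda>(k::nat) (x, y). f x + real k / 2 * (norm (x - y))\<^sup>2 + (norm (x - p))\<^sup>2)"
  have D: "compact D" "p \<in> D" "D \<subseteq> cball p e"
    using closed p e unfolding D_def
    by (auto simp: compact_eq_bounded_closed intro: bounded_subset[OF bounded_cball])
  have cont: "continuous_on (cball p e) f" by (rule lipschitz_on_continuous_on[OF lip])
  have L: "L \<ge> 0" by (rule lipschitz_on_nonneg[OF lip])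
  have lipD: "f x \<le> f y + L * norm (x - y)" if "x \<in> cball p e" "y \<in> cball p e" for x y
    using lipschitz_onD[OF lip that] by (simp add: dist_norm)
  have "\<exists>z \<in> cball p e \<times> D. \<forall>w \<in> cball p e \<times> D. P k z \<le> P k w" for k
    unfolding P_def case_prod_unfold
    using D e
    by (intro continuous_attains_inf compact_Times continuous_intros continuous_on_compose2[OF cont]) auto
  then obtain Z where Z: "\<And>k. Z k \<in> cball p e \<times> D"
    "\<And>k w. w \<in> cball p e \<times> D \<Longrightarrow> P k (Z k) \<le> P k w" by metis
  define X where "X k = fst (Z k)" for k
  define Y where "Y k = snd (Z k)" for k
  have X: "X k \<in> cball p e" and Y: "Y k \<in> D" for k
    using Z(1)[of k] by (auto simp: X_def Y_def mem_Times_iff)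
  have Ycb: "Y k \<in> cball p e" "Y k \<in> C" for k using Y[of k] by (auto simp: D_def)
  have opt: "f (X k) + real k / 2 * (norm (X k - Y k))\<^sup>2 + (norm (X k - p))\<^sup>2
      \<le> f x + real k / 2 * (norm (x - y))\<^sup>2 + (norm (x - p))\<^sup>2"
    if "x \<in> cball p e" "y \<in> D" for k x y
    using Z(2)[of "(x, y)" k] that by (simp add: P_def X_def Y_def case_prod_unfold)
  \<comment> \<open>\<open>L\<close> comes from comparing \<open>f\<close> at \<open>X k\<close> and
    \<open>Y k\<close>, and \<open>2 * e\<close> from factoring the difference of the squared
    distances to \<open>p\<close>, both distances being at most \<open>e\<close>. The factor 2
    clears the penalty weight \<open>k / 2\<close>.\<close>
  define M where "M = 2 * (L + 2 * e)"
  have M: "M \<ge> 0" using L e by (simp add: M_def)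
  have bound: "real k * norm (X k - Y k) \<le> M" for k
  proof -
    define d where "d = norm (X k - Y k)"
    have 1: "f (X k) + real k / 2 * d\<^sup>2 + (norm (X k - p))\<^sup>2 \<le> f (Y k) + (norm (Y k - p))\<^sup>2"
      using opt[of "Y k" "Y k" k] Ycb Y by (simp add: d_def)
    have 2: "f (Y k) \<le> f (X k) + L * d"
      using lipD[of "Y k" "X k"] Ycb X by (simp add: d_def norm_minus_commute)
    have a: "norm (Y k - p) \<le> e" "norm (X k - p) \<le> e"
      using Ycb(1)[of k] X[of k] by (auto simp: dist_norm norm_minus_commute)
    have b: "norm (Y k - p) - norm (X k - p) \<le> d"
      using norm_triangle_ineq2[of "Y k - p" "X k - p"] by (simp add: d_def norm_minus_commute)
    have "(norm (Y k - p))\<^sup>2 - (norm (X k - p))\<^sup>2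
        = (norm (Y k - p) - norm (X k - p)) * (norm (Y k - p) + norm (X k - p))"
      by (simp add: power2_eq_square algebra_simps)
    also have "\<dots> \<le> d * (2 * e)"
      using a b by (intro mult_mono) (auto simp: d_def)
    finally have "real k * d * d \<le> M * d"
      using 1 2 by (simp add: M_def power2_eq_square algebra_simps)
    then have "real k * d \<le> M" if "d > 0" using that mult_right_le_imp_le by blast
    moreover have "real k * d \<le> M" if "d = 0" using that M by simp
    moreover have "d \<ge> 0" by (simp add: d_def)
    ultimately show ?thesis by (fastforce simp: d_def)
  qed
  have dist_XY: "norm (X k - Y k) \<le> M / real k" if "k > 0" for k
    using bound[of k] that by (simp add: field_simps)
  have XY: "(\<lambda>k. X k - Y k) \<longlonglongrightarrow> 0"
  proof (rule Lim_null_comparison)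
    show "\<forall>\<^sub>F k in sequentially. norm (X k - Y k) \<le> M / real k"
      by (rule eventually_mono[OF eventually_gt_at_top[of 0]]) (rule dist_XY)
    show "(\<lambda>k. M / real k) \<longlonglongrightarrow> 0" by (rule lim_const_over_n)
  qed
  \<comment> \<open>Compare with the pair \<open>(p, p)\<close>. Since \<open>Y k\<close> lies in
    \<open>C\<close>, local minimality at \<open>p\<close> gives \<open>f p\<close> \<le>
    \<open>f (Y k)\<close>, and the Lipschitz bound carries this over to \<open>X k\<close>.\<close>
  have conv: "(norm (X k - p))\<^sup>2 \<le> L * norm (X k - Y k)" for k
  proof -
    have "f (X k) + real k / 2 * (norm (X k - Y k))\<^sup>2 + (norm (X k - p))\<^sup>2 \<le> f p"
      using opt[of p p k] D e by simp
    moreover have "f p \<le> f (Y k)" using min Y by (simp add: D_def)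
    moreover have "f (Y k) \<le> f (X k) + L * norm (X k - Y k)"
      using lipD[of "Y k" "X k"] Ycb X by (simp add: norm_minus_commute)
    moreover have "real k / 2 * (norm (X k - Y k))\<^sup>2 \<ge> 0" by simp
    ultimately show ?thesis by linarith
  qed
  have "(\<lambda>k. L * norm (X k - Y k)) \<longlonglongrightarrow> 0"
    using XY by (intro tendsto_mult_right_zero tendsto_norm_zero)
  then have "(\<lambda>k. (norm (X k - p))\<^sup>2) \<longlonglongrightarrow> 0"
    by (rule Lim_null_comparison[rotated]) (use conv in auto)
  then have "(\<lambda>k. norm (X k - p)) \<longlonglongrightarrow> 0"
    using tendsto_real_sqrt by fastforce
  then have Xp: "X \<longlonglongrightarrow> p" using LIM_zero_cancel tendsto_norm_zero_iff by blast
  have Yp: "Y \<longlonglongrightarrow> p" using tendsto_diff[OF Xp XY] by simp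
  \<comment> \<open>\<open>V k\<close> is minus the gradient in \<open>x\<close> of the two
    quadratic terms at \<open>(X k, Y k)\<close>; \<open>W k\<close> is minus their gradient in
    \<open>y\<close>.\<close>
  define W where "W k = real k *\<^sub>R (X k - Y k)" for k
  define V where "V k = - W k - 2 *\<^sub>R (X k - p)" for k
  have expand: "(norm (x - b))\<^sup>2 - (norm (a - b))\<^sup>2 = 2 * ((a - b) \<bullet> (x - a)) + (norm (x - a))\<^sup>2"
    for x a b :: 'a
    by (simp add: power2_norm_eq_inner inner_diff inner_commute)
  \<comment> \<open>Quadratic remainders are of lower order than the norm; this absorbs the last
    term of \<open>expand\<close>.\<close>
  have small: "\<forall>\<^sub>F x in at a. K * (norm (x - a))\<^sup>2 \<le> \<epsilon> * norm (x - a)"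
    if "\<epsilon> > 0" for K \<epsilon> and a :: 'a
  proof -
    have "((\<lambda>x. K * norm (x - a)) \<longlongrightarrow> K * norm (a - a)) (at a)" by (intro tendsto_intros)
    then have "\<forall>\<^sub>F x in at a. K * norm (x - a) < \<epsilon>"
      using that by (intro order_tendstoD(2)) auto
    then show ?thesis
    proof eventually_elim
      case (elim x)
      then have "(K * norm (x - a)) * norm (x - a) \<le> \<epsilon> * norm (x - a)"
        by (intro mult_right_mono) auto
      then show ?case by (simp add: power2_eq_square mult.assoc)
    qed
  qed
  \<comment> \<open>Optimality in \<open>x\<close> with \<open>Y k\<close> fixed. It holds only
    within \<open>cball p e\<close>, so \<open>X k\<close> must be interior for nearby points to be
    admissible. The remainder coefficient is \<open>k / 2\<close> from the penalty plus 1 from the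
    term centred at \<open>p\<close>.\<close>
  have V: "V k \<in> regular_subdifferential f (X k)" if "X k \<in> ball p e" for k
    unfolding regular_subdifferential_def mem_Collect_eq
  proof (intro allI impI)
    fix \<epsilon> :: real assume "\<epsilon> > 0"
    have "\<forall>\<^sub>F x in at (X k). x \<in> ball p e" using that by (intro eventually_at_in_open') auto
    with small[OF \<open>\<epsilon> > 0\<close>, of "real k / 2 + 1" "X k"]
    show "\<forall>\<^sub>F x in at (X k). f (X k) + V k \<bullet> (x - X k) - \<epsilon> * norm (x - X k) \<le> f x"
    proof eventually_elim
      case (elim x)
      have "f (X k) \<le> f x + real k / 2 * ((norm (x - Y k))\<^sup>2 - (norm (X k - Y k))\<^sup>2)
          + ((norm (x - p))\<^sup>2 - (norm (X k - p))\<^sup>2)"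
        using opt[of x "Y k" k] elim(2) Y by (simp add: algebra_simps)
      also have "\<dots> = f x - V k \<bullet> (x - X k) + (real k / 2 + 1) * (norm (x - X k))\<^sup>2"
        unfolding expand V_def W_def inner_diff_left inner_minus_left inner_scaleR_left
        by (simp add: algebra_simps inner_diff_left)
      finally show ?case using elim(1) by linarith
    qed
  qed
  \<comment> \<open>Optimality in \<open>y\<close> with \<open>X k\<close> fixed: \<open>f\<close>
    and the term centred at \<open>p\<close> cancel, leaving a comparison of squared distances to
    \<open>X k\<close>.\<close>
  have W: "W k \<in> regular_normal_cone C (Y k)" if "Y k \<in> ball p e" for k
    unfolding regular_normal_cone_def mem_Collect_eq
  proof (intro conjI allI impI)
    show "Y k \<in> C" using Ycb by simp
    fix \<epsilon> :: real assume "\<epsilon> > 0"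
    have "\<forall>\<^sub>F y in at (Y k). y \<in> ball p e" using that by (intro eventually_at_in_open') auto
    with small[OF \<open>\<epsilon> > 0\<close>, of "real k / 2" "Y k"]
    have "\<forall>\<^sub>F y in at (Y k). y \<in> C \<longrightarrow> W k \<bullet> (y - Y k) \<le> \<epsilon> * norm (y - Y k)"
    proof eventually_elim
      case (elim y)
      show ?case
      proof
        assume "y \<in> C"
        then have "0 \<le> real k / 2 * ((norm (y - X k))\<^sup>2 - (norm (Y k - X k))\<^sup>2)"
          using opt[of "X k" y k] X elim(2) by (simp add: D_def algebra_simps norm_minus_commute)
        also have "\<dots> = - (W k \<bullet> (y - Y k)) + real k / 2 * (norm (y - Y k))\<^sup>2"
          unfolding expand W_def by (simp add: algebra_simps inner_diff_left)
        finally show "W k \<bullet> (y - Y k) \<le> \<epsilon> * norm (y - Y k)" using elim(1) by linarith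
      qed
    qed
    then show "\<forall>\<^sub>F y in at (Y k) within C. W k \<bullet> (y - Y k) \<le> \<epsilon> * norm (y - Y k)"
      by (auto simp: eventually_at_filter elim: eventually_mono)
  qed
  have "W k \<in> cball 0 M" for k using bound by (simp add: W_def)
  then obtain w r where r: "strict_mono r" and w: "(W \<circ> r) \<longlonglongrightarrow> w"
    using compact_cball[of "0::'a" M] unfolding compact_def by (metis)
  have "\<forall>\<^sub>F k in sequentially. X k \<in> ball p e \<and> Y k \<in> ball p e"
    using topological_tendstoD[OF Xp, of "ball p e"] topological_tendstoD[OF Yp, of "ball p e"] e
    by (simp add: eventually_conj)
  then obtain N where N: "\<And>k. k \<ge> N \<Longrightarrow> X k \<in> ball p e \<and> Y k \<in> ball p e"
    by (auto simp: eventually_sequentially)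
  \<comment> \<open>The limiting notions demand regular vectors at every index. Shifting by
    \<open>N\<close> makes all indices at least \<open>N\<close>, since \<open>r\<close> is strictly
    increasing, so every iterate is in the open ball.\<close>
  define s where "s k = r (k + N)" for k
  have s: "strict_mono s" "s k \<ge> N" for k
    using r seq_suble[OF r, of "k + N"] by (auto simp: s_def strict_mono_def intro: order_trans)
  have Xs: "(\<lambda>k. X (s k)) \<longlonglongrightarrow> p" and Ys: "(\<lambda>k. Y (s k)) \<longlonglongrightarrow> p"
    using LIMSEQ_subseq_LIMSEQ[OF Xp s(1)] LIMSEQ_subseq_LIMSEQ[OF Yp s(1)] by (simp_all add: o_def)
  have Ws: "(\<lambda>k. W (s k)) \<longlonglongrightarrow> w"
    using LIMSEQ_ignore_initial_segment[OF w, of N] by (simp add: s_def o_def)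
  have Vs: "(\<lambda>k. V (s k)) \<longlonglongrightarrow> - w"
  proof -
    have "(\<lambda>k. - W (s k) - 2 *\<^sub>R (X (s k) - p)) \<longlonglongrightarrow> - w - 2 *\<^sub>R (p - p)"
      by (intro tendsto_intros Ws Xs)
    then show ?thesis by (simp add: V_def)
  qed
  have fXs: "(\<lambda>k. f (X (s k))) \<longlonglongrightarrow> f p"
    using continuous_on_tendsto_compose[OF cont Xs] X e by simp
  show ?thesis
  proof (rule bexI[of _ "- w"])
    show "- w \<in> limiting_subdifferential f p"
      unfolding limiting_subdifferential_def mem_Collect_eq
      using Xs Vs fXs V N s(2) by (intro exI[of _ "\<lambda>k. X (s k)"] exI[of _ "\<lambda>k. V (s k)"]) auto
    show "- (- w) \<in> limiting_normal_cone C p"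
      unfolding limiting_normal_cone_def mem_Collect_eq minus_minus
      using Ys Ws W N s(2) Ycb(2) p
      by (intro conjI exI[of _ "\<lambda>k. Y (s k)"] exI[of _ "\<lambda>k. W (s k)"]) auto
  qed
qed

section \<open>Closedness of the constraint sets\<close>

lemma closed_entrywise:
  fixes I :: "'m::finite \<Rightarrow> 'n::finite \<Rightarrow> 'a::topological_space set"
  assumes "\<And>i j. closed (I i j)"
  shows "closed {Z :: 'a^'n^'m. \<forall>i j. Z $ i $ j \<in> I i j}"
  using closed_vector_box[of "\<lambda>i. {y. \<forall>j. y $ j \<in> I i j}"] closed_vector_box[of "I _"] assms
  by simp

lemma closed_matrix_box: "matrix_box B \<Longrightarrow> closed B"
  unfolding matrix_box_def using closed_entrywise by blast

text \<open>Each entry interval contains 0, so zeroing entries never leaves the box; conversely, a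
  matrix vanishing outside \<open>J\<close> is its own restriction.\<close>

lemma box_S_restricted_eq:
  assumes "\<And>i j. \<kappa>1 i j \<le> 0" and "\<And>i j. \<kappa>2 i j \<ge> 0"
  shows "box_S_restricted \<kappa>1 \<kappa>2 J = {S \<in> box_S \<kappa>1 \<kappa>2. \<forall>i j. (i, j) \<notin> J \<longrightarrow> S $ i $ j = 0}"
    (is "_ = ?R")
proof
  show "box_S_restricted \<kappa>1 \<kappa>2 J \<subseteq> ?R"
    using assms by (auto simp: box_S_restricted_def box_S_def restrict_entries_def zero_ereal_def[symmetric])
  show "?R \<subseteq> box_S_restricted \<kappa>1 \<kappa>2 J"
  proof
    fix S assume S: "S \<in> ?R"
    then have "S = restrict_entries J S" by (auto simp: restrict_entries_def vec_eq_iff)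
    with S show "S \<in> box_S_restricted \<kappa>1 \<kappa>2 J" unfolding box_S_restricted_def by blast
  qed
qed

lemma closed_box_S: "closed (box_S \<kappa>1 \<kappa>2)"
proof -
  have "closed {x. \<kappa>1 i j \<le> ereal x \<and> ereal x \<le> \<kappa>2 i j}" for i j
    by (intro closed_Collect_conj closed_Collect_le continuous_on_const continuous_on_ereal continuous_on_id)
  from closed_entrywise[OF this] show ?thesis by (simp add: box_S_def)
qed

lemma closed_box_S_restricted:
  assumes "\<And>i j. \<kappa>1 i j \<le> 0" and "\<And>i j. \<kappa>2 i j \<ge> 0"
  shows "closed (box_S_restricted \<kappa>1 \<kappa>2 J)"
proof -
  have "closed (if (i, j) \<in> J then UNIV else {0 :: real})" for i j by simp
  from closed_Int[OF closed_box_S closed_entrywise[OF this]] show ?thesis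
    unfolding box_S_restricted_eq[OF assms]
    by (rule back_subst[of closed]) auto
qed

text \<open>A set of fixed rank need not be closed, as limits may lose rank. Near \<open>Z\<close>
  the rank cannot fall below \<open>rank Z\<close>, so there the equality is equivalent to a closed
  upper bound; for \<open>lam = 0\<close> it is vacuous.\<close>

lemma locally_closed_box_Z_rank:
  assumes "closed BZ"
  shows "\<exists>e>0. closed (box_Z_rank BZ d lam Z \<inter> cball Z e)"
proof -
  obtain e where e: "e > 0" "\<And>B. dist B Z \<le> e \<Longrightarrow> rank Z \<le> rank B"
    using rank_lower_semicontinuous by blast
  show ?thesis
  proof (intro exI conjI)
    show "e > 0" by fact
    have "box_Z_rank BZ d lam Z \<inter> cball Z e
      = BZ \<inter> {B. rank B \<le> d} \<inter> (if lam = 0 then UNIV else {B. rank B \<le> rank Z}) \<inter> cball Z e"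
      using e(2) by (auto simp: box_Z_rank_def dist_commute intro: le_antisym)
    also have "closed \<dots>"
      using assms by (auto intro!: closed_Int closed_rank_le)
    finally show "closed (box_Z_rank BZ d lam Z \<inter> cball Z e)" .
  qed
qed

section \<open>Local equivalence of (LB) and the restricted problem\<close>

lemma l0_norm_mono:
  assumes "\<And>i j. S $ i $ j \<noteq> 0 \<Longrightarrow> T $ i $ j \<noteq> 0"
  shows "l0_norm S \<le> l0_norm T"
  unfolding l0_norm_def using assms by (intro card_mono) auto

lemma l0_norm_strict_mono:
  assumes "\<And>i j. S $ i $ j \<noteq> 0 \<Longrightarrow> T $ i $ j \<noteq> 0" "T $ i $ j \<noteq> 0" "S $ i $ j = 0"
  shows "l0_norm S < l0_norm T"
proof -
  have "{(i, j). S $ i $ j \<noteq> 0} \<subset> {(i, j). T $ i $ j \<noteq> 0}"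
    using assms by (intro psubsetI subsetI) (auto simp: set_eq_iff)
  then show ?thesis unfolding l0_norm_def by (intro psubset_card_mono) auto
qed

lemma locally_lipschitz_isCont:
  assumes "locally_lipschitz f"
  shows "isCont f x"
proof -
  obtain u L where u: "u > 0" "L-lipschitz_on (cball x u) f"
    using assms unfolding locally_lipschitz_def by blast
  then have "continuous_on (ball x u) f"
    by (meson ball_subset_cball continuous_on_subset lipschitz_on_continuous_on)
  then show ?thesis
    using u(1) by (simp add: continuous_on_eq_continuous_at)
qed

text \<open>On the restricted set the rank term is constant and the \<open>l0_norm\<close> term is
  no larger than at the centre, so an inequality between objectives yields one for \<open>f\<close>.
  Conversely, a nearby feasible point either lies in that set or pays for a jump of a
  regularizer.\<close>

lemma LB_local_minimizer_iff:
  fixes f :: "(real^'n^'m) \<times> (real^'n^'m) \<Rightarrow> real"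
  assumes lam: "lam \<ge> 0" and \<beta>: "\<beta> \<ge> 0" and f: "isCont f (Zbar, Sbar)"
    and \<kappa>: "\<And>i j. \<kappa>1 i j \<le> 0" "\<And>i j. \<kappa>2 i j \<ge> 0"
  shows "LB_local_minimizer f lam \<beta> BZ (box_S \<kappa>1 \<kappa>2) d (Zbar, Sbar) \<longleftrightarrow>
    local_minimizer_on f
      (box_Z_rank BZ d lam Zbar \<times> box_S_restricted \<kappa>1 \<kappa>2 (J_set \<beta> Sbar)) (Zbar, Sbar)"
    (is "?LB \<longleftrightarrow> local_minimizer_on f ?R _")
proof
  \<comment> \<open>The restricted set is the feasible set with two further conditions; their
    failures give the cases below.\<close>
  have R: "(Z, S) \<in> ?R \<longleftrightarrow> (Z, S) \<in> LB_feasible BZ (box_S \<kappa>1 \<kappa>2) d \<and>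
      lam * real (rank Z) = lam * real (rank Zbar) \<and>
      (\<beta> > 0 \<longrightarrow> (\<forall>i j. Sbar $ i $ j = 0 \<longrightarrow> S $ i $ j = 0))" for Z S
    by (auto simp: box_S_restricted_eq[OF \<kappa>] box_Z_rank_def LB_feasible_def J_set_def)
  {
    assume ?LB
    then obtain e where e: "e > 0" and feas: "(Zbar, Sbar) \<in> LB_feasible BZ (box_S \<kappa>1 \<kappa>2) d"
      and min: "\<And>y. y \<in> LB_feasible BZ (box_S \<kappa>1 \<kappa>2) d \<Longrightarrow> dist y (Zbar, Sbar) < e
        \<Longrightarrow> LB_objective f lam \<beta> (Zbar, Sbar) \<le> LB_objective f lam \<beta> y"
      unfolding LB_local_minimizer_def local_minimizer_on_def by blast
    have "f (Zbar, Sbar) \<le> f (Z, S)" if S: "(Z, S) \<in> ?R" "dist (Z, S) (Zbar, Sbar) < e" for Z S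
    proof -
      have "LB_objective f lam \<beta> (Zbar, Sbar) \<le> LB_objective f lam \<beta> (Z, S)"
        using S R by (intro min) blast+
      moreover have "lam * real (rank Z) = lam * real (rank Zbar)" using S(1) R by blast
      moreover have "\<beta> * real (l0_norm S) \<le> \<beta> * real (l0_norm Sbar)"
      proof (cases "\<beta> > 0")
        case True
        with S(1) have "l0_norm S \<le> l0_norm Sbar" unfolding R by (intro l0_norm_mono) blast
        with True show ?thesis by simp
      qed (use \<beta> in simp)
      ultimately show ?thesis by (auto simp: LB_objective_def)
    qed
    moreover have "(Zbar, Sbar) \<in> ?R" unfolding R using feas by auto
    ultimately show "local_minimizer_on f ?R (Zbar, Sbar)"
      unfolding local_minimizer_on_def using e by (metis surj_pair)
  }
  assume "local_minimizer_on f ?R (Zbar, Sbar)"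
  then obtain e1 where e1: "e1 > 0" and mem: "(Zbar, Sbar) \<in> ?R"
    and min: "\<And>y. y \<in> ?R \<Longrightarrow> dist y (Zbar, Sbar) < e1 \<Longrightarrow> f (Zbar, Sbar) \<le> f y"
    unfolding local_minimizer_on_def by blast
  \<comment> \<open>\<open>f\<close> may drop by less than \<delta>, whereas one rank jump costs at
    least \<open>2 * lam\<close> and one new nonzero entry at least \<beta>. The value 1 is a
    default for a vanishing parameter, whose regularizer excludes no point.\<close>
  define \<delta> where "\<delta> = min (if lam > 0 then 2 * lam else 1) (if \<beta> > 0 then \<beta> else 1)"
  have \<delta>: "\<delta> > 0" "lam > 0 \<Longrightarrow> \<delta> \<le> 2 * lam" "\<beta> > 0 \<Longrightarrow> \<delta> \<le> \<beta>"
    by (auto simp: \<delta>_def)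
  obtain e2 where e2: "e2 > 0" "\<And>y. dist y (Zbar, Sbar) < e2 \<Longrightarrow> dist (f y) (f (Zbar, Sbar)) < \<delta>"
    using f \<delta>(1) unfolding continuous_at_eps_delta by blast
  obtain e3 where e3: "e3 > 0" "\<And>Z. dist Z Zbar \<le> e3 \<Longrightarrow> rank Zbar \<le> rank Z"
    using rank_lower_semicontinuous by blast
  obtain e4 where e4: "e4 > 0"
    "\<And>S i j. dist S Sbar < e4 \<Longrightarrow> Sbar $ i $ j \<noteq> 0 \<Longrightarrow> S $ i $ j \<noteq> 0"
    using support_subset_nearby[of Sbar] by blast
  define e where "e = Min {e1, e2, e3, e4}"
  have "LB_objective f lam \<beta> (Zbar, Sbar) \<le> LB_objective f lam \<beta> (Z, S)"
    if feas: "(Z, S) \<in> LB_feasible BZ (box_S \<kappa>1 \<kappa>2) d" and near: "dist (Z, S) (Zbar, Sbar) < e" for Z S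
  proof -
    have dist: "dist (Z, S) (Zbar, Sbar) < e1" "dist (Z, S) (Zbar, Sbar) < e2"
      "dist Z Zbar \<le> e3" "dist S Sbar < e4"
      using near dist_fst_le[of "(Z, S)" "(Zbar, Sbar)"] dist_snd_le[of "(Z, S)" "(Zbar, Sbar)"]
      by (auto simp: e_def)
    have rank: "rank Zbar \<le> rank Z" by (rule e3(2)[OF dist(3)])
    have supp: "Sbar $ i $ j \<noteq> 0 \<Longrightarrow> S $ i $ j \<noteq> 0" for i j by (rule e4(2)[OF dist(4)])
    have f_ge: "f (Zbar, Sbar) - \<delta> \<le> f (Z, S)" using e2(2)[OF dist(2)] by (simp add: dist_real_def)
    have rank_le: "lam * real (rank Zbar) \<le> lam * real (rank Z)"
      using lam rank by (intro mult_left_mono) auto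
    have l0_le: "\<beta> * real (l0_norm Sbar) \<le> \<beta> * real (l0_norm S)"
      using \<beta> l0_norm_mono[OF supp] by (intro mult_left_mono) auto
    consider "lam * real (rank Z) \<noteq> lam * real (rank Zbar)"
      | i j where "\<beta> > 0" "Sbar $ i $ j = 0" "S $ i $ j \<noteq> 0"
      | "(Z, S) \<in> ?R"
      using feas R by blast
    then show ?thesis
    proof cases
      case 1
      then have "lam > 0" "rank Zbar + 1 \<le> rank Z" using lam rank by auto
      then have "lam * (real (rank Zbar) + 1) \<le> lam * real (rank Z)"
        by (intro mult_left_mono) auto
      then show ?thesis
        using f_ge \<delta>(2)[OF \<open>lam > 0\<close>] l0_le by (simp add: LB_objective_def algebra_simps)
    next
      case 2
      have "l0_norm Sbar + 1 \<le> l0_norm S" using l0_norm_strict_mono[OF supp 2(3,2)] by simp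
      then have "\<beta> * (real (l0_norm Sbar) + 1) \<le> \<beta> * real (l0_norm S)"
        using 2(1) by (intro mult_left_mono) auto
      then show ?thesis
        using f_ge \<delta>(3)[OF 2(1)] rank_le by (simp add: LB_objective_def algebra_simps)
    next
      case 3
      then show ?thesis
        using min[OF 3 dist(1)] rank_le l0_le by (simp add: LB_objective_def)
    qed
  qed
  moreover have "e > 0" using e1 e2 e3 e4 by (simp add: e_def)
  moreover have "(Zbar, Sbar) \<in> LB_feasible BZ (box_S \<kappa>1 \<kappa>2) d" using mem R by blast
  ultimately show ?LB
    unfolding LB_local_minimizer_def local_minimizer_on_def by (metis surj_pair)
qed

section \<open>Stationarity of local minimizers\<close>

text \<open>The Fermat rule is applied once to the product and the normal vector is then split. The
  pair \<open>(v, w)\<close> is thus a single joint subgradient rather than two partial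
  ones.\<close>

lemma local_minimizer_on_Times_stationary:
  fixes f :: "'a::euclidean_space \<times> 'b::euclidean_space \<Rightarrow> real"
  assumes lip: "locally_lipschitz f" and min: "local_minimizer_on f (A \<times> B) (a, b)"
    and A: "e1 > 0" "closed (A \<inter> cball a e1)" and B: "closed B"
  shows "\<exists>v w. (v, w) \<in> limiting_subdifferential f (a, b) \<and>
    - v \<in> limiting_normal_cone A a \<and> - w \<in> limiting_normal_cone B b"
proof -
  obtain e2 where e2: "e2 > 0" and mem: "(a, b) \<in> A \<times> B"
    and le: "\<And>y. y \<in> A \<times> B \<Longrightarrow> dist y (a, b) < e2 \<Longrightarrow> f (a, b) \<le> f y"
    using min unfolding local_minimizer_on_def by blast
  obtain e3 L where e3: "e3 > 0" "L-lipschitz_on (cball (a, b) e3) f"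
    using lip unfolding locally_lipschitz_def by blast
  \<comment> \<open>Halving \<open>e2\<close> fits a closed ball inside the open one on which
    minimality is known.\<close>
  define e where "e = Min {e1, e2 / 2, e3}"
  have e: "e > 0" "e \<le> e1" "e < e2" "e \<le> e3"
    using A(1) e2 e3(1) by (auto simp: e_def min_less_iff_disj)
  \<comment> \<open>Points of the product ball have first coordinate within \<open>e1\<close> of
    \<open>a\<close>, so local closedness of \<open>A\<close> suffices.\<close>
  have "(A \<times> B) \<inter> cball (a, b) e = ((A \<inter> cball a e1) \<times> B) \<inter> cball (a, b) e"
    using e(2) dist_fst_le[of "(a, b)"] by (fastforce intro: order_trans)
  then have "closed ((A \<times> B) \<inter> cball (a, b) e)"
    using A(2) B by (auto intro!: closed_Int closed_Times)
  moreover have "L-lipschitz_on (cball (a, b) e) f"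
    using e(4) by (intro lipschitz_on_subset[OF e3(2)] subset_cball)
  moreover have "f (a, b) \<le> f y" if "y \<in> (A \<times> B) \<inter> cball (a, b) e" for y
    using that e(3) by (intro le) (auto simp: dist_commute)
  ultimately obtain v where v: "v \<in> limiting_subdifferential f (a, b)"
    "- v \<in> limiting_normal_cone (A \<times> B) (a, b)"
    using limiting_fermat_rule[OF e(1) _ _ mem] by blast
  then show ?thesis
    using limiting_normal_cone_Times[OF v(2)]
    by (intro exI[of _ "fst v"] exI[of _ "snd v"]) simp
qed

theorem proposition3:
  fixes f :: "(real^'n^'m) \<times> (real^'n^'m) \<Rightarrow> real"
    and d :: nat
    and lam \<beta> :: real
    and \<kappa>1 \<kappa>2 :: "'m \<Rightarrow> 'n \<Rightarrow> ereal"
    and BZ :: "(real^'n^'m) set"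
    and Zbar Sbar :: "real^'n^'m"
  assumes "d > 0"
    and "lam \<ge> 0" and "\<beta> \<ge> 0"
    and "\<And>W. f W \<ge> 0"
    and "locally_lipschitz f"
    and "\<And>i j. \<kappa>1 i j \<le> 0" and "\<And>i j. \<kappa>2 i j \<ge> 0"
    and "matrix_box BZ"
  shows "(LB_local_minimizer f lam \<beta> BZ (box_S \<kappa>1 \<kappa>2) d (Zbar, Sbar) \<longleftrightarrow>
            local_minimizer_on f
              (box_Z_rank BZ d lam Zbar \<times> box_S_restricted \<kappa>1 \<kappa>2 (J_set \<beta> Sbar)) (Zbar, Sbar))
       \<and> (LB_local_minimizer f lam \<beta> BZ (box_S \<kappa>1 \<kappa>2) d (Zbar, Sbar) \<longrightarrow>
            rank Zbar \<le> d \<and>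
            (\<exists>HZ HS. (HZ, HS) \<in> limiting_subdifferential f (Zbar, Sbar) \<and>
               - HZ \<in> limiting_normal_cone (box_Z_rank BZ d lam Zbar) Zbar \<and>
               - HS \<in> limiting_normal_cone (box_S_restricted \<kappa>1 \<kappa>2 (J_set \<beta> Sbar)) Sbar))"
proof (intro conjI impI)
  show iff: "LB_local_minimizer f lam \<beta> BZ (box_S \<kappa>1 \<kappa>2) d (Zbar, Sbar) \<longleftrightarrow>
      local_minimizer_on f
        (box_Z_rank BZ d lam Zbar \<times> box_S_restricted \<kappa>1 \<kappa>2 (J_set \<beta> Sbar)) (Zbar, Sbar)"
    using assms(2,3,6,7) locally_lipschitz_isCont[OF assms(5)] by (intro LB_local_minimizer_iff)
  assume LB: "LB_local_minimizer f lam \<beta> BZ (box_S \<kappa>1 \<kappa>2) d (Zbar, Sbar)"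
  then show "rank Zbar \<le> d"
    by (simp add: LB_local_minimizer_def local_minimizer_on_def LB_feasible_def)
  obtain e where "e > 0" "closed (box_Z_rank BZ d lam Zbar \<inter> cball Zbar e)"
    using locally_closed_box_Z_rank closed_matrix_box[OF assms(8)] by blast
  then show "\<exists>HZ HS. (HZ, HS) \<in> limiting_subdifferential f (Zbar, Sbar) \<and>
      - HZ \<in> limiting_normal_cone (box_Z_rank BZ d lam Zbar) Zbar \<and>
      - HS \<in> limiting_normal_cone (box_S_restricted \<kappa>1 \<kappa>2 (J_set \<beta> Sbar)) Sbar"
    using LB iff assms(5) closed_box_S_restricted[OF assms(6,7)]
    by (intro local_minimizer_on_Times_stationary) auto
qed

end
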